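(* Let $k\ge 1$ be an integer and let $n=m^2$ for a positive integer $m$ such that $t=\frac{\sqrt{n}}{2k}-\frac12$ is a nonnegative integer. Set $T=\sqrt{n}/k$. Then for every sufficiently large $P>1$, the vector $(y^n_I)_{I\subseteq[n]}$ defined by $y^n_I=\alpha$ for every $I\subseteq[n]$ with $|I|\le 2t+1$ and $y^n_I=0$ otherwise, where $\alpha>0$ is chosen so that $\sum_{I\subseteq[n]}y^n_I=1$, is feasible for $\mathrm{Las}_t(LP(T))$.
   Context: Scheduling instance: $n=m^2$ unit-cost jobs partitioned into blocks $N_1,\dots,N_m$ of $m$ jobs each; the jobs of block $N_i$ have processing time $P^i$ (with $P>1$), and the demand at the deadline of block $i$ is $D_i=\sum_{j=1}^{i}P^{j-1}$. Variables $x_{ij}$, $i,j\in[m]$, are identified with the elements of $[n]$ via $(i,j)\mapsto (i-1)m+j$. $LP(T)$ consists of the linear constraints $g_0(x)=T-\sum_{i=1}^m\sum_{j=1}^m x_{ij}\ge 0$ and, for each $\ell\in[m]$, $g_\ell(x)=\sum_{i=1}^{\ell}\sum_{j=1}^m P^i x_{ij}-D_\ell\ge 0$. For $I\subseteq[n]$, $x_I\in\{0,1\}^n$ denotes the indicator vector of $I$ ($x_i=1$ iff $i\in I$). For an integer $d\ge 0$, $\mathcal{P}_d(n)$ is the family of subsets of $[n]$ of size at most $d$, and for $I\subseteq[n]$ the zeta vector $Z_I\in\mathbb{R}^{\mathcal{P}_d(n)}$ has entries $[Z_I]_J=1$ if $J\subseteq I$ and $0$ otherwise. The Lasserre relaxation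 $\mathrm{Las}_t(LP(T))$ at level $t$ is the set of real vectors $(y^n_I)_{I\subseteq[n]}$ satisfying: (i) $\sum_{I\subseteq[n]}y^n_I=1$; (ii) $\sum_{I\subseteq[n]}y^n_I Z_IZ_I^\top\succeq 0$ with $Z_I\in\mathbb{R}^{\mathcal{P}_{t+1}(n)}$; (iii) for each constraint $g\in\{g_0,g_1,\dots,g_m\}$, $\sum_{I\subseteq[n]}g(x_I)\,y^n_I Z_IZ_I^\top\succeq 0$ with $Z_I\in\mathbb{R}^{\mathcal{P}_{t}(n)}$. Here $\succeq 0$ means positive semidefinite. *)

theory Defs
  imports Complex_Main
begin

text \<open>
  The ground set \<open>[n]\<close> is \<open>{1..n}\<close>. A point of \<open>\<real>\<^sup>n\<close> is a function \<open>nat \<Rightarrow> real\<close> of which only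
  the values on \<open>{1..n}\<close> matter, a vector \<open>(y\<^sub>I)\<close> with \<open>I \<subseteq> [n]\<close> is a function \<open>nat set \<Rightarrow> real\<close> of
  which only the values on \<open>Pow {1..n}\<close> matter, and a matrix with rows and columns indexed by a
  finite set \<open>S\<close> is a binary function of which only the values on \<open>S \<times> S\<close> matter.
\<close>

definition psd_on :: "'a set \<Rightarrow> ('a \<Rightarrow> 'a \<Rightarrow> real) \<Rightarrow> bool" where
  "psd_on S M \<longleftrightarrow>
     (\<forall>A\<in>S. \<forall>B\<in>S. M A B = M B A) \<and>
     (\<forall>v :: 'a \<Rightarrow> real. 0 \<le> (\<Sum>A\<in>S. \<Sum>B\<in>S. v A * M A B * v B))"

definition subsets_upto :: "nat \<Rightarrow> nat \<Rightarrow> nat set set" where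
  "subsets_upto d n = {I. I \<subseteq> {1..n} \<and> card I \<le> d}"

definition indicator_vec :: "nat set \<Rightarrow> nat \<Rightarrow> real" where
  "indicator_vec I i = (if i \<in> I then 1 else 0)"

definition zeta_vec :: "nat set \<Rightarrow> nat set \<Rightarrow> real" where
  "zeta_vec I J = (if J \<subseteq> I then 1 else 0)"

text \<open>
  The matrix \<open>\<Sum>\<^sub>I w\<^sub>I Z\<^sub>I Z\<^sub>I\<^sup>T\<close>, entry by entry; the truncation to sets of size at most \<open>d\<close> is done
  by the index set given to \<^const>\<open>psd_on\<close>.
\<close>

definition zeta_matrix :: "nat \<Rightarrow> (nat set \<Rightarrow> real) \<Rightarrow> nat set \<Rightarrow> nat set \<Rightarrow> real" where
  "zeta_matrix n w J K = (\<Sum>I\<in>Pow {1..n}. w I * (zeta_vec I J * zeta_vec I K))"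

text \<open>A constraint \<open>g(x) \<ge> 0\<close> is represented by the function \<open>g\<close>.\<close>

definition Las :: "nat \<Rightarrow> nat \<Rightarrow> ((nat \<Rightarrow> real) \<Rightarrow> real) set \<Rightarrow> (nat set \<Rightarrow> real) set" where
  "Las t n G = {y.
     (\<Sum>I\<in>Pow {1..n}. y I) = 1 \<and>
     psd_on (subsets_upto (t + 1) n) (zeta_matrix n y) \<and>
     (\<forall>g\<in>G. psd_on (subsets_upto t n) (zeta_matrix n (\<lambda>I. g (indicator_vec I) * y I)))}"

definition var_index :: "nat \<Rightarrow> nat \<Rightarrow> nat \<Rightarrow> nat" where
  "var_index m i j = (i - 1) * m + j"

definition demand :: "real \<Rightarrow> nat \<Rightarrow> real" where
  "demand P i = (\<Sum>j=1..i. P ^ (j - 1))"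

definition cost_constraint :: "nat \<Rightarrow> real \<Rightarrow> (nat \<Rightarrow> real) \<Rightarrow> real" where
  "cost_constraint m T x = T - (\<Sum>i=1..m. \<Sum>j=1..m. x (var_index m i j))"

definition demand_constraint :: "nat \<Rightarrow> real \<Rightarrow> nat \<Rightarrow> (nat \<Rightarrow> real) \<Rightarrow> real" where
  "demand_constraint m P l x =
     (\<Sum>i=1..l. \<Sum>j=1..m. P ^ i * x (var_index m i j)) - demand P l"

definition LP :: "nat \<Rightarrow> real \<Rightarrow> real \<Rightarrow> ((nat \<Rightarrow> real) \<Rightarrow> real) set" where
  "LP m P T = insert (cost_constraint m T) (demand_constraint m P ` {1..m})"

definition uniform_vec :: "nat \<Rightarrow> nat \<Rightarrow> real \<Rightarrow> nat set \<Rightarrow> real" where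
  "uniform_vec n d \<alpha> I = (if I \<subseteq> {1..n} \<and> card I \<le> d then \<alpha> else 0)"

end

theory Submission
  imports Defs
begin

text \<open>
  The quadratic form of \<open>\<Sum>\<^sub>I w\<^sub>I Z\<^sub>I Z\<^sub>I\<^sup>T\<close> at \<open>v\<close> is \<open>\<Sum>\<^sub>I w\<^sub>I f(I)\<^sup>2\<close> with \<open>f(I) = \<Sum>\<^bsub>J \<subseteq> I\<^esub> v\<^sub>J\<close>. It is trivially
  nonnegative for the moment matrix and, since \<open>T = 2t + 1\<close>, for the cost constraint. The demand
  constraint of block \<open>N\<close> with index \<open>l\<close> is at least \<open>P\<^sup>l\<^sup>-\<^sup>1 (P - 2)\<close> on sets that meet \<open>N\<close> and at least
  \<open>-2 P\<^sup>l\<^sup>-\<^sup>1\<close> on the others, so for large \<open>P\<close> it is enough to bound the values of \<open>f\<close> on the latter by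
  its values on the former, with a constant independent of \<open>P\<close>. If \<open>|J| \<le> t\<close> and \<open>J\<close> misses \<open>N\<close>, take
  \<open>W \<subseteq> N\<close> with \<open>|W| = t + 1\<close>: because \<open>f\<close> has degree at most \<open>t\<close>, the alternating sum of \<open>f(J \<union> U)\<close>
  over \<open>U \<subseteq> W\<close> vanishes, which expresses \<open>f(J)\<close> through sets of size at most \<open>2t + 1\<close> that meet \<open>N\<close>.
  By Moebius inversion the values of \<open>f\<close> on sets of size at most \<open>t\<close> determine \<open>f\<close>.
\<close>

section \<open>Alternating sums and low-degree set functions\<close>

lemma sum_Pow_insert:
  assumes "finite W" "w \<notin> W"
  shows "(\<Sum>U\<in>Pow (insert w W). h U) = (\<Sum>U\<in>Pow W. h U) + (\<Sum>U\<in>Pow W. h (insert w U))"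
proof -
  have "inj_on (insert w) (Pow W)"
    using assms by (auto simp: inj_on_def)
  moreover have "Pow W \<inter> insert w ` Pow W = {}"
    using assms by auto
  ultimately show ?thesis
    using assms by (simp add: Pow_insert sum.union_disjoint sum.reindex)
qed

text \<open>Each element of \<open>W\<close> acts as a discrete derivative, which keeps only the
  coefficients of sets containing it. For \<open>A = {}\<close> this is Moebius inversion up to
  sign; it gives 0 when \<open>card W\<close> exceeds the degree.\<close>

lemma alternating_sum_subset_sums:
  fixes v :: "'a set \<Rightarrow> real"
  assumes "finite W" "finite A" "A \<inter> W = {}"
  shows "(\<Sum>U\<in>Pow W. (-1) ^ card U * (\<Sum>J\<in>Pow (A \<union> U). v J))
       = (-1) ^ card W * (\<Sum>B\<in>Pow A. v (W \<union> B))"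
  using assms
proof (induction W arbitrary: A rule: finite_induct)
  case empty
  then show ?case by simp
next
  case (insert w W)
  let ?F = "\<lambda>X. \<Sum>J\<in>Pow X. v J"
  have w: "w \<notin> A" and AW: "A \<inter> W = {}"
    using insert.prems by auto
  have "(-1) ^ card (insert w U) * ?F (A \<union> insert w U)
      = - ((-1) ^ card U * ?F (insert w A \<union> U))" if "U \<in> Pow W" for U
  proof -
    have "finite U" "w \<notin> U"
      using that insert.hyps finite_subset by auto
    then show ?thesis by simp
  qed
  then have "(\<Sum>U\<in>Pow W. (-1) ^ card (insert w U) * ?F (A \<union> insert w U))
      = - (\<Sum>U\<in>Pow W. (-1) ^ card U * ?F (insert w A \<union> U))"
    by (simp add: sum_negf)
  also have "\<dots> = - ((-1) ^ card W * (\<Sum>B\<in>Pow (insert w A). v (W \<union> B)))"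
    using insert.IH[of "insert w A"] insert.prems insert.hyps by simp
  \<comment> \<open>The sum over \<open>B\<close> without \<open>w\<close> cancels against the
    induction hypothesis for \<open>A\<close>.\<close>
  also have "(\<Sum>B\<in>Pow (insert w A). v (W \<union> B))
      = (\<Sum>B\<in>Pow A. v (W \<union> B)) + (\<Sum>B\<in>Pow A. v (insert w W \<union> B))"
    using insert.prems w by (simp add: sum_Pow_insert)
  finally show ?case
    using insert.IH[of A] insert.prems insert.hyps AW
    by (simp add: sum_Pow_insert algebra_simps)
qed

lemma abs_sum_Pow_le:
  fixes h :: "'a set \<Rightarrow> real"
  assumes "finite W" and "\<And>U. U \<subseteq> W \<Longrightarrow> \<bar>h U\<bar> \<le> b"
  shows "\<bar>\<Sum>U\<in>Pow W. h U\<bar> \<le> 2 ^ card W * b"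
proof -
  have "\<bar>\<Sum>U\<in>Pow W. h U\<bar> \<le> (\<Sum>U\<in>Pow W. \<bar>h U\<bar>)"
    by (rule sum_abs)
  also have "\<dots> \<le> of_nat (card (Pow W)) * b"
    using assms by (intro sum_bounded_above) auto
  finally show ?thesis
    using assms by (simp add: card_Pow)
qed

text \<open>The factors count terms, from right to left: subsets of \<open>W\<close> in the
  alternating sum, subsets of a set of size at most \<open>t\<close> in Moebius inversion, subsets
  of \<open>I\<close> in the definition of \<open>f\<close>.\<close>

lemma low_degree_bound:
  fixes v :: "'a set \<Rightarrow> real"
  defines "f \<equiv> \<lambda>I. \<Sum>J\<in>Pow I. v J"
  assumes "finite V" "N \<subseteq> V" "t + 1 \<le> card N" "b \<ge> 0"
    and deg: "\<And>J. card J > t \<Longrightarrow> v J = 0"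
    and meet: "\<And>I. I \<subseteq> V \<Longrightarrow> card I \<le> 2 * t + 1 \<Longrightarrow> I \<inter> N \<noteq> {} \<Longrightarrow> \<bar>f I\<bar> \<le> b"
    and "I \<subseteq> V"
  shows "\<bar>f I\<bar> \<le> 2 ^ card V * (2 ^ t * (2 ^ (t + 1) * b))"
proof -
  have b: "b \<le> 2 ^ s * b" for s :: nat
    using \<open>b \<ge> 0\<close> mult_right_mono[of 1 "2 ^ s" b] by simp
  have small: "\<bar>f J\<bar> \<le> 2 ^ (t + 1) * b" if J: "J \<subseteq> V" "card J \<le> t" for J
  proof (cases "J \<inter> N = {}")
    case False
    then show ?thesis
      using meet[of J] J b[of "t + 1"] by linarith
  next
    case True
    obtain W where W: "W \<subseteq> N" "card W = t + 1" "finite W"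
      using obtain_subset_with_card_n[OF \<open>t + 1 \<le> card N\<close>] by metis
    have finJ: "finite J"
      using J \<open>finite V\<close> finite_subset by blast
    have JW: "J \<inter> W = {}"
      using True W by auto
    have zero: "v (W \<union> B) = 0" if "B \<in> Pow J" for B
    proof (rule deg)
      have "card W \<le> card (W \<union> B)"
        using that W finJ finite_subset by (intro card_mono) auto
      then show "t < card (W \<union> B)"
        using W by simp
    qed
    \<comment> \<open>The term at \<open>U = {}\<close> is \<open>f J\<close> itself. Every other
      \<open>J \<union> U\<close> meets \<open>N\<close>, since \<open>U\<close> is a nonempty part
      of \<open>N\<close>.\<close>
    let ?h = "\<lambda>U. if U = {} then 0 else (-1) ^ card U * f (J \<union> U)"
    have "0 = (\<Sum>U\<in>Pow W. (-1) ^ card U * f (J \<union> U))"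
      using alternating_sum_subset_sums[OF W(3) finJ JW, of v] zero by (simp add: f_def)
    also have "\<dots> = f J + (\<Sum>U\<in>Pow W - {{}}. (-1) ^ card U * f (J \<union> U))"
      using W by (subst sum.remove[of _ "{}"]) auto
    also have "(\<Sum>U\<in>Pow W - {{}}. (-1) ^ card U * f (J \<union> U)) = (\<Sum>U\<in>Pow W. ?h U)"
      using W by (intro sum.mono_neutral_cong_left) auto
    finally have "\<bar>f J\<bar> = \<bar>\<Sum>U\<in>Pow W. ?h U\<bar>"
      by linarith
    also have "\<dots> \<le> 2 ^ card W * b"
    proof (rule abs_sum_Pow_le[OF W(3)])
      fix U assume U: "U \<subseteq> W"
      \<comment> \<open>The sizes \<open>t\<close> and \<open>t + 1\<close> add up to exactly the
        bound \<open>2 * t + 1\<close> in \<open>meet\<close>.\<close>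
      have "card U \<le> t + 1"
        using U W card_mono by metis
      then have "card (J \<union> U) \<le> 2 * t + 1"
        using card_Un_le[of J U] J by linarith
      then show "\<bar>?h U\<bar> \<le> b"
        using meet[of "J \<union> U"] U W J \<open>N \<subseteq> V\<close> \<open>b \<ge> 0\<close> by (auto simp: abs_mult)
    qed
    finally show ?thesis
      using W by simp
  qed
  have coeff: "\<bar>v J\<bar> \<le> 2 ^ t * (2 ^ (t + 1) * b)" if J: "J \<subseteq> V" for J
  proof (cases "card J \<le> t")
    case False
    then show ?thesis
      using deg \<open>b \<ge> 0\<close> by simp
  next
    case True
    have finJ: "finite J"
      using J \<open>finite V\<close> finite_subset by blast
    have "\<bar>v J\<bar> = \<bar>\<Sum>U\<in>Pow J. (-1) ^ card U * f U\<bar>"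
      using alternating_sum_subset_sums[of J "{}" v] finJ by (simp add: f_def abs_mult)
    also have "\<dots> \<le> 2 ^ card J * (2 ^ (t + 1) * b)"
    proof (rule abs_sum_Pow_le[OF finJ])
      fix U assume U: "U \<subseteq> J"
      then have "card U \<le> t"
        using card_mono[OF finJ U] True by linarith
      then show "\<bar>(-1) ^ card U * f U\<bar> \<le> 2 ^ (t + 1) * b"
        using small[of U] J U by (simp add: abs_mult)
    qed
    also have "\<dots> \<le> 2 ^ t * (2 ^ (t + 1) * b)"
      using True \<open>b \<ge> 0\<close> by (intro mult_right_mono power_increasing) auto
    finally show ?thesis .
  qed
  have "finite I"
    using \<open>I \<subseteq> V\<close> \<open>finite V\<close> finite_subset by blast
  then have "\<bar>f I\<bar> \<le> 2 ^ card I * (2 ^ t * (2 ^ (t + 1) * b))"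
    unfolding f_def using coeff \<open>I \<subseteq> V\<close> by (intro abs_sum_Pow_le) auto
  also have "\<dots> \<le> 2 ^ card V * (2 ^ t * (2 ^ (t + 1) * b))"
    using \<open>b \<ge> 0\<close> \<open>I \<subseteq> V\<close> \<open>finite V\<close> by (intro mult_right_mono power_increasing card_mono) auto
  finally show ?thesis .
qed

section \<open>Quadratic forms of zeta matrices\<close>

lemma finite_subsets_upto: "finite (subsets_upto d n)"
  by (rule finite_subset[of _ "Pow {1..n}"]) (auto simp: subsets_upto_def)

text \<open>Truncating the index set amounts to setting the coefficients of larger sets to 0, which
  gives a function of degree at most \<open>d\<close>.\<close>

lemma sum_zeta_vec:
  assumes "I \<subseteq> {1..n}"
  shows "(\<Sum>A\<in>subsets_upto d n. v A * zeta_vec I A)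
       = (\<Sum>J\<in>Pow I. if card J \<le> d then v J else 0)"
proof -
  have fin: "finite (Pow I)"
    using assms finite_subset by auto
  have "(\<Sum>A\<in>subsets_upto d n. v A * zeta_vec I A) = (\<Sum>A\<in>subsets_upto d n \<inter> Pow I. v A)"
    using finite_subsets_upto[of d n]
    by (auto simp: zeta_vec_def sum.inter_restrict intro!: sum.cong)
  also have "subsets_upto d n \<inter> Pow I = {J \<in> Pow I. card J \<le> d}"
    using assms by (auto simp: subsets_upto_def)
  finally show ?thesis
    using sum.inter_filter[OF fin] by simp
qed

text \<open>Each summand of the matrix has rank one, so the quadratic form is a weighted sum of
  squares.\<close>

lemma psd_on_zeta_matrix:
  "psd_on S (zeta_matrix n w) \<longleftrightarrow>
     (\<forall>v. 0 \<le> (\<Sum>I\<in>Pow {1..n}. w I * (\<Sum>A\<in>S. v A * zeta_vec I A)\<^sup>2))"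
proof -
  have "(\<Sum>A\<in>S. \<Sum>B\<in>S. v A * zeta_matrix n w A B * v B)
      = (\<Sum>I\<in>Pow {1..n}. w I * (\<Sum>A\<in>S. v A * zeta_vec I A)\<^sup>2)" for v
  proof -
    have "(\<Sum>A\<in>S. \<Sum>B\<in>S. v A * zeta_matrix n w A B * v B)
        = (\<Sum>A\<in>S. \<Sum>B\<in>S. \<Sum>I\<in>Pow {1..n}. w I * ((v A * zeta_vec I A) * (v B * zeta_vec I B)))"
      unfolding zeta_matrix_def sum_distrib_left sum_distrib_right
      by (intro sum.cong refl) (simp add: mult_ac)
    also have "\<dots> = (\<Sum>A\<in>S. \<Sum>I\<in>Pow {1..n}. \<Sum>B\<in>S. w I * ((v A * zeta_vec I A) * (v B * zeta_vec I B)))"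
      by (intro sum.cong refl sum.swap)
    also have "\<dots> = (\<Sum>I\<in>Pow {1..n}. \<Sum>A\<in>S. \<Sum>B\<in>S. w I * ((v A * zeta_vec I A) * (v B * zeta_vec I B)))"
      by (rule sum.swap)
    also have "\<dots> = (\<Sum>I\<in>Pow {1..n}. w I * (\<Sum>A\<in>S. v A * zeta_vec I A)\<^sup>2)"
      unfolding power2_eq_square sum_product by (simp add: sum_distrib_left)
    finally show ?thesis .
  qed
  moreover have "zeta_matrix n w A B = zeta_matrix n w B A" for A B
    by (simp add: zeta_matrix_def mult_ac)
  ultimately show ?thesis
    by (simp add: psd_on_def)
qed

lemma psd_on_zeta_matrix_nonneg:
  assumes "\<And>I. I \<subseteq> {1..n} \<Longrightarrow> w I \<ge> 0"
  shows "psd_on S (zeta_matrix n w)"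
  unfolding psd_on_zeta_matrix using assms by (auto intro!: sum_nonneg)

text \<open>\<open>C\<close> is the squared constant of \<open>low_degree_bound\<close> times
  \<open>2 ^ n\<close>, a bound on the number of sets missing \<open>N\<close>. It depends only on
  \<open>n\<close> and \<open>t\<close>.\<close>

lemma psd_on_zeta_matrix_meet:
  fixes \<alpha> :: real and n t :: nat
  defines "C \<equiv> 2 ^ n * (2 ^ n * (2 ^ t * 2 ^ (t + 1)))\<^sup>2"
  assumes "N \<subseteq> {1..n}" "t + 1 \<le> card N" "\<alpha> \<ge> 0" "q \<ge> 0" "p \<ge> C * q"
    and pos: "\<And>I. I \<subseteq> {1..n} \<Longrightarrow> I \<inter> N \<noteq> {} \<Longrightarrow> g I \<ge> p"
    and neg: "\<And>I. I \<subseteq> {1..n} \<Longrightarrow> g I \<ge> - q"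
  shows "psd_on (subsets_upto t n) (zeta_matrix n (\<lambda>I. g I * uniform_vec n (2 * t + 1) \<alpha> I))"
  unfolding psd_on_zeta_matrix
proof
  fix v :: "nat set \<Rightarrow> real"
  define v' where "v' J = (if card J \<le> t then v J else 0)" for J
  define f where "f I = (\<Sum>J\<in>Pow I. v' J)" for I
  define M where "M = {I \<in> subsets_upto (2 * t + 1) n. I \<inter> N \<noteq> {}}"
  define D where "D = {I \<in> subsets_upto (2 * t + 1) n. I \<inter> N = {}}"
  \<comment> \<open>Each square is at most \<open>s\<close>, so \<open>sqrt s\<close> can serve as
    the bound \<open>b\<close> in \<open>low_degree_bound\<close>.\<close>
  define s where "s = (\<Sum>I\<in>M. (f I)\<^sup>2)"
  have fin: "finite M" "finite D"
    using finite_subsets_upto[of "2 * t + 1" n] by (simp_all add: M_def D_def)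
  have s0: "s \<ge> 0"
    by (auto simp: s_def intro: sum_nonneg)
  have meet: "\<bar>f I\<bar> \<le> sqrt s" if "I \<subseteq> {1..n}" "card I \<le> 2 * t + 1" "I \<inter> N \<noteq> {}" for I
  proof (rule real_le_rsqrt)
    have "I \<in> M"
      using that by (simp add: M_def subsets_upto_def)
    then have "(f I)\<^sup>2 \<le> s"
      unfolding s_def using fin by (intro member_le_sum) auto
    then show "\<bar>f I\<bar>\<^sup>2 \<le> s" by simp
  qed
  have "(f I)\<^sup>2 \<le> (2 ^ n * (2 ^ t * 2 ^ (t + 1)))\<^sup>2 * s" if "I \<subseteq> {1..n}" for I
  proof -
    have "\<bar>f I\<bar> \<le> 2 ^ card {1..n} * (2 ^ t * (2 ^ (t + 1) * sqrt s))"
      unfolding f_def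
      by (rule low_degree_bound[where N = N])
        (use assms(2,3) s0 meet that in \<open>auto simp: v'_def f_def\<close>)
    then have "\<bar>f I\<bar> \<le> (2 ^ n * (2 ^ t * 2 ^ (t + 1))) * sqrt s"
      by (simp add: mult_ac)
    then have "\<bar>f I\<bar>\<^sup>2 \<le> ((2 ^ n * (2 ^ t * 2 ^ (t + 1))) * sqrt s)\<^sup>2"
      by (intro power_mono) auto
    then show ?thesis
      using s0 by (simp only: power_mult_distrib[of _ "sqrt s"] power2_abs real_sqrt_pow2)
  qed
  then have "(\<Sum>I\<in>D. (f I)\<^sup>2) \<le> of_nat (card D) * ((2 ^ n * (2 ^ t * 2 ^ (t + 1)))\<^sup>2 * s)"
    by (intro sum_bounded_above) (auto simp: D_def subsets_upto_def)
  also have "\<dots> \<le> 2 ^ n * ((2 ^ n * (2 ^ t * 2 ^ (t + 1)))\<^sup>2 * s)"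
  proof (rule mult_right_mono)
    have "card D \<le> card (Pow {1..n})"
      by (intro card_mono) (auto simp: D_def subsets_upto_def)
    then have "card D \<le> 2 ^ n"
      by (simp add: card_Pow)
    then show "real (card D) \<le> 2 ^ n"
      by (metis of_nat_le_iff of_nat_numeral of_nat_power)
  qed (use s0 in simp)
  finally have D: "(\<Sum>I\<in>D. (f I)\<^sup>2) \<le> C * s"
    by (simp add: C_def)
  have "q * (\<Sum>I\<in>D. (f I)\<^sup>2) \<le> q * (C * s)"
    using D \<open>q \<ge> 0\<close> by (rule mult_left_mono)
  also have "\<dots> \<le> p * s"
    using mult_right_mono[OF \<open>p \<ge> C * q\<close> s0] by (simp add: mult_ac)
  also have "\<dots> \<le> (\<Sum>I\<in>M. g I * (f I)\<^sup>2)"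
    unfolding s_def sum_distrib_left
    by (intro sum_mono mult_right_mono pos) (auto simp: M_def subsets_upto_def)
  finally have 1: "q * (\<Sum>I\<in>D. (f I)\<^sup>2) \<le> (\<Sum>I\<in>M. g I * (f I)\<^sup>2)" .
  have 2: "- q * (\<Sum>I\<in>D. (f I)\<^sup>2) \<le> (\<Sum>I\<in>D. g I * (f I)\<^sup>2)"
    unfolding sum_distrib_left
    by (intro sum_mono mult_right_mono neg) (auto simp: D_def subsets_upto_def)
  have "0 \<le> \<alpha> * ((\<Sum>I\<in>M. g I * (f I)\<^sup>2) + (\<Sum>I\<in>D. g I * (f I)\<^sup>2))"
    using 1 2 \<open>\<alpha> \<ge> 0\<close> by (intro mult_nonneg_nonneg) auto
  also have "(\<Sum>I\<in>M. g I * (f I)\<^sup>2) + (\<Sum>I\<in>D. g I * (f I)\<^sup>2) = (\<Sum>I\<in>M \<union> D. g I * (f I)\<^sup>2)"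
    using fin by (intro sum.union_disjoint[symmetric]) (auto simp: M_def D_def)
  also have "\<alpha> * \<dots> = (\<Sum>I\<in>Pow {1..n}. g I * uniform_vec n (2 * t + 1) \<alpha> I * (f I)\<^sup>2)"
    unfolding sum_distrib_left
    by (rule sum.mono_neutral_cong_left)
      (auto simp: M_def D_def subsets_upto_def uniform_vec_def)
  also have "\<dots> = (\<Sum>I\<in>Pow {1..n}. g I * uniform_vec n (2 * t + 1) \<alpha> I
                    * (\<Sum>A\<in>subsets_upto t n. v A * zeta_vec I A)\<^sup>2)"
    by (intro sum.cong refl) (simp add: sum_zeta_vec f_def v'_def)
  finally show "0 \<le> \<dots>" .
qed

section \<open>Bounds on the scheduling constraints\<close>

lemma inj_on_var_index: "inj_on (\<lambda>(i, j). var_index m i j) ({1..m} \<times> {1..m})"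
proof (rule inj_onI, clarify)
  fix i j i' j'
  assume ij: "i \<in> {1..m}" "j \<in> {1..m}" "i' \<in> {1..m}" "j' \<in> {1..m}"
    and eq: "var_index m i j = var_index m i' j'"
  \<comment> \<open>Both coordinates start at 1; after shifting to 0 they are the quotient and
    remainder modulo \<open>m\<close>.\<close>
  have *: "(var_index m a b - 1) div m = a - 1 \<and> (var_index m a b - 1) mod m = b - 1"
    if "b \<in> {1..m}" for a b
  proof -
    have "var_index m a b - 1 = (b - 1) + (a - 1) * m" and "b - 1 < m"
      using that by (auto simp: var_index_def)
    then show ?thesis by simp
  qed
  have "i - 1 = i' - 1" "j - 1 = j' - 1"
    using *[of j i] *[of j' i'] ij eq by auto
  then show "i = i' \<and> j = j'"
    using ij by auto
qed

lemma var_index_in_ground: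
  assumes "i \<in> {1..m}" "j \<in> {1..m}"
  shows "var_index m i j \<in> {1..m\<^sup>2}"
proof -
  have "var_index m i j \<le> (i - 1) * m + m"
    using assms by (simp add: var_index_def)
  also have "\<dots> = i * m"
    using assms by (cases i) auto
  also have "\<dots> \<le> m * m"
    using assms by simp
  finally show ?thesis
    using assms by (auto simp: power2_eq_square var_index_def)
qed

text \<open>By injectivity of the indexing, the sum of the variables counts distinct elements of
  \<open>I\<close>.\<close>

lemma cost_constraint_ge:
  assumes "finite I"
  shows "cost_constraint m T (indicator_vec I) \<ge> T - real (card I)"
proof -
  let ?x = "\<lambda>(i, j). var_index m i j"
  let ?S = "{p \<in> {1..m} \<times> {1..m}. ?x p \<in> I}"
  have "(\<Sum>i=1..m. \<Sum>j=1..m. indicator_vec I (var_index m i j))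
      = (\<Sum>p\<in>{1..m} \<times> {1..m}. if ?x p \<in> I then 1 else 0)"
    by (simp add: sum.cartesian_product indicator_vec_def case_prod_beta)
  also have "\<dots> = (\<Sum>p\<in>?S. 1)"
    by (subst sum.inter_filter) auto
  also have "\<dots> = real (card ?S)"
    by simp
  also have "card ?S \<le> card I"
    using assms by (intro card_inj_on_le[of ?x] inj_on_subset[OF inj_on_var_index]) auto
  finally show ?thesis
    by (simp add: cost_constraint_def)
qed

lemma demand_le:
  assumes "P \<ge> 2" "l \<ge> 1"
  shows "demand P l \<le> 2 * P ^ (l - 1)"
  using \<open>l \<ge> 1\<close>
proof (induction l rule: dec_induct)
  case base
  then show ?case by (simp add: demand_def)
next
  case (step l)
  have "demand P (Suc l) = demand P l + P ^ l"
    by (simp add: demand_def)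
  also have "\<dots> \<le> 2 * P ^ (l - 1) + P ^ l"
    using step by simp
  \<comment> \<open>This is where \<open>P \<ge> 2\<close> enters: the bound on the earlier terms is
    absorbed into one more \<open>P ^ l\<close>.\<close>
  also have "2 * P ^ (l - 1) \<le> P * P ^ (l - 1)"
    using assms by (intro mult_right_mono) auto
  also have "P * P ^ (l - 1) = P ^ l"
    using step by (metis power_eq_if not_one_le_zero)
  finally show ?case by simp
qed

lemma demand_constraint_ge:
  assumes "P \<ge> 2" "l \<ge> 1"
  shows "demand_constraint m P l (indicator_vec I) \<ge> - (2 * P ^ (l - 1))"
proof -
  have "(\<Sum>i=1..l. \<Sum>j=1..m. P ^ i * indicator_vec I (var_index m i j)) \<ge> 0"
    using assms by (intro sum_nonneg) (auto simp: indicator_vec_def)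
  then show ?thesis
    using demand_le[OF assms] by (simp add: demand_constraint_def)
qed

text \<open>A single job of block \<open>l\<close> already contributes \<open>P ^ l\<close>, and the
  demand is at most \<open>2 * P ^ (l - 1)\<close>.\<close>

lemma demand_constraint_meet_ge:
  assumes "P \<ge> 2" "l \<ge> 1" and "I \<inter> var_index m l ` {1..m} \<noteq> {}"
  shows "demand_constraint m P l (indicator_vec I) \<ge> (P - 2) * P ^ (l - 1)"
proof -
  obtain j where j: "j \<in> {1..m}" "var_index m l j \<in> I"
    using assms(3) by blast
  let ?h = "\<lambda>i j. P ^ i * indicator_vec I (var_index m i j)"
  have nonneg: "?h i j \<ge> 0" for i j
    using assms by (auto simp: indicator_vec_def)
  have "P * P ^ (l - 1) = ?h l j"
    using assms j by (simp add: indicator_vec_def power_eq_if)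
  also have "\<dots> \<le> (\<Sum>j=1..m. ?h l j)"
    using j nonneg by (intro member_le_sum) auto
  also have "\<dots> \<le> (\<Sum>i=1..l. \<Sum>j=1..m. ?h i j)"
    using assms nonneg by (intro member_le_sum[where f = "\<lambda>i. \<Sum>j=1..m. ?h i j"] sum_nonneg) auto
  finally show ?thesis
    using demand_le[OF assms(1,2)] by (simp add: demand_constraint_def algebra_simps)
qed

section \<open>Feasibility of the uniform vector\<close>

theorem theorem1:
  fixes k m n t :: nat and T :: real
  assumes "k \<ge> 1"
    and "m \<ge> 1"
    and "n = m ^ 2"
    and "real t = sqrt (real n) / (2 * real k) - 1 / 2"
    and "T = sqrt (real n) / real k"
  shows "\<exists>\<alpha>>0. (\<Sum>I\<in>Pow {1..n}. uniform_vec n (2 * t + 1) \<alpha> I) = 1 \<and>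
           (\<exists>P0>1. \<forall>P\<ge>P0. uniform_vec n (2 * t + 1) \<alpha> \<in> Las t n (LP m P T))"
proof -
  define d where "d = 2 * t + 1"
  define \<alpha> where "\<alpha> = 1 / real (card (subsets_upto d n))"
  define C :: real where "C = 2 ^ n * (2 ^ n * (2 ^ t * 2 ^ (t + 1)))\<^sup>2"
  \<comment> \<open>The assumption on \<open>t\<close> says exactly that
    \<open>sqrt n = k * (2 * t + 1)\<close>; hence \<open>T = d\<close>, and every block has room
    for \<open>t + 1\<close> jobs.\<close>
  have md: "real m = real k * real d"
    using assms by (simp add: d_def field_simps)
  have T: "T = real d"
    using assms md by simp
  from md have "m = k * d"
    by (metis of_nat_eq_iff of_nat_mult)
  then have tm: "t + 1 \<le> m"
    using \<open>k \<ge> 1\<close> mult_le_mono1[of 1 k d] by (simp add: d_def)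
  have "{} \<in> subsets_upto d n"
    by (simp add: subsets_upto_def)
  then have card: "card (subsets_upto d n) > 0"
    using finite_subsets_upto card_gt_0_iff by blast
  then have \<alpha>: "\<alpha> > 0"
    by (simp add: \<alpha>_def)
  have "(\<Sum>I\<in>Pow {1..n}. uniform_vec n d \<alpha> I) = (\<Sum>I\<in>subsets_upto d n. \<alpha>)"
    by (rule sum.mono_neutral_cong_right) (auto simp: subsets_upto_def uniform_vec_def)
  then have total: "(\<Sum>I\<in>Pow {1..n}. uniform_vec n d \<alpha> I) = 1"
    using card by (simp add: \<alpha>_def)
  \<comment> \<open>The threshold is the condition \<open>p \<ge> C * q\<close> for
    \<open>p = (P - 2) * P ^ (l - 1)\<close> and \<open>q = 2 * P ^ (l - 1)\<close>, with the common
    power cancelled; it is the same for all \<open>l\<close>.\<close>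
  have "uniform_vec n d \<alpha> \<in> Las t n (LP m P T)" if P: "P \<ge> 2 + 2 * C" for P
  proof -
    have "C \<ge> 0"
      by (simp add: C_def)
    then have P2: "P \<ge> 2"
      using P by simp
    have moment: "psd_on (subsets_upto (t + 1) n) (zeta_matrix n (uniform_vec n d \<alpha>))"
      using \<alpha> by (intro psd_on_zeta_matrix_nonneg) (simp add: uniform_vec_def)
    have cost: "psd_on (subsets_upto t n)
        (zeta_matrix n (\<lambda>I. cost_constraint m T (indicator_vec I) * uniform_vec n d \<alpha> I))"
    proof (rule psd_on_zeta_matrix_nonneg)
      fix I assume "I \<subseteq> {1..n}"
      then have "cost_constraint m T (indicator_vec I) \<ge> T - real (card I)"
        using cost_constraint_ge finite_subset by blast
      \<comment> \<open>Sets with more than \<open>d = T\<close> elements have weight 0.\<close>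
      then show "0 \<le> cost_constraint m T (indicator_vec I) * uniform_vec n d \<alpha> I"
        using \<alpha> T by (auto simp: uniform_vec_def)
    qed
    have demand: "psd_on (subsets_upto t n)
        (zeta_matrix n (\<lambda>I. demand_constraint m P l (indicator_vec I) * uniform_vec n d \<alpha> I))"
      if l: "l \<in> {1..m}" for l
      unfolding d_def
    proof (rule psd_on_zeta_matrix_meet[where N = "var_index m l ` {1..m}"
          and p = "(P - 2) * P ^ (l - 1)" and q = "2 * P ^ (l - 1)"])
      show "var_index m l ` {1..m} \<subseteq> {1..n}"
        using var_index_in_ground[OF l] \<open>n = m ^ 2\<close> by auto
      have "inj_on (var_index m l) {1..m}"
        by (auto simp: inj_on_def var_index_def)
      then show "t + 1 \<le> card (var_index m l ` {1..m})"
        using tm by (simp add: card_image)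
      have "2 * C * P ^ (l - 1) \<le> (P - 2) * P ^ (l - 1)"
        using P P2 by (intro mult_right_mono) auto
      then show "2 ^ n * (2 ^ n * (2 ^ t * 2 ^ (t + 1)))\<^sup>2 * (2 * P ^ (l - 1)) \<le> (P - 2) * P ^ (l - 1)"
        by (simp add: C_def mult_ac)
      show "(P - 2) * P ^ (l - 1) \<le> demand_constraint m P l (indicator_vec I)"
        if "I \<inter> var_index m l ` {1..m} \<noteq> {}" for I
        using demand_constraint_meet_ge[OF P2 _ that] l by simp
      show "- (2 * P ^ (l - 1)) \<le> demand_constraint m P l (indicator_vec I)" for I
        using demand_constraint_ge[OF P2] l by simp
    qed (use \<alpha> P2 in auto)
    show ?thesis
      using total moment cost demand by (auto simp: Las_def LP_def)
  qed
  moreover have "2 + 2 * C > 1"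
    by (simp add: C_def add_pos_nonneg)
  ultimately show ?thesis
    using \<alpha> total unfolding d_def by blast
qed

end
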